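(* Let $G$ be a connected graph obtained by point-attaching from pairwise disjoint connected graphs $G_1,\ldots,G_k$. For distinct $i,j\in[k]$ let $\delta_{ij}=d_G(G_i,G_j)$, and let $x_{i\rightarrow j}\in V(G_i)$ and $x_{j\rightarrow i}\in V(G_j)$ be the (unique) vertices realizing this distance, i.e. $d_G(x_{i\rightarrow j},x_{j\rightarrow i})=\delta_{ij}$ (if $G_i$ and $G_j$ share a vertex $x$, then $x_{i\rightarrow j}=x_{j\rightarrow i}=x$ and $\delta_{ij}=0$). Then $$H(G,t)=\sum_{i=1}^k H(G_i,t)+\sum_{\{i,j\}\in\binom{[k]}{2}} H_{x_{i\rightarrow j}}(G_i,t)\cdot H_{x_{j\rightarrow i}}(G_j,t)\cdot t^{\delta_{ij}}.$$
   Context: All graphs are finite, simple and connected; $d_G(u,v)$ is the shortest-path distance in $G$, and for subgraphs $H_1,H_2$ of $G$, $d_G(H_1,H_2)=\min\{d_G(u,v): u\in V(H_1),v\in V(H_2)\}$. For a positive integer $n$, $[n]=\{1,\ldots,n\}$, and $\binom{A}{2}$ is the set of 2-element subsets of $A$. The Hosoya polynomial of a connected graph $G$ is $H(G,t)=\sum_{\{u,v\}\in\binom{V(G)}{2}} t^{d_G(u,v)}$ (no constant term). For $u\in V(G)$, the partial Hosoya polynomial with respect to $u$ is $H_u(G,t)=\sum_{v\in V(G), v\neq u} t^{d_G(u,v)}$. A graph $G$ is obtained by point-attaching from pairwise disjoint connected graphs $G_1,\ldots,G_k$ if it is built inductively as follows: select a vertex of $G_1$ and a vertex of $G_2$ and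 identify them; then, having used $G_1,\ldots,G_i$ ($2\le i\le k-1$), select a vertex of the graph constructed so far (possibly a previously selected vertex) and a vertex of $G_{i+1}$ and identify these two vertices. The $G_i$ are regarded as subgraphs of $G$ (the primary subgraphs). *)

theory Defs
  imports
    "Graph_Theory.Digraph_Component"
    "Graph_Theory.Pair_Digraph"
    "HOL-Computational_Algebra.Polynomial"
begin

text \<open>
  Finite simple graphs are modelled, as in \<open>Graph_Theory\<close>, by finite loop-free symmetric digraphs
  without parallel arcs (\<open>pair_graph\<close>): an edge between two vertices is the pair of opposite arcs.
  The notion \<open>Digraph_Component.connected\<close> requires at least one vertex.
\<close>

definition connected_graph :: "'a pair_pre_digraph \<Rightarrow> bool" where
  "connected_graph G \<longleftrightarrow> pair_graph G \<and> Digraph_Component.connected (with_proj G)"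

subsection \<open>Distance\<close>

text \<open>Only meaningful when some walk joins the two vertices.\<close>

definition graph_dist :: "'a pair_pre_digraph \<Rightarrow> 'a \<Rightarrow> 'a \<Rightarrow> nat" where
  "graph_dist G u v = (LEAST n. \<exists>p. pre_digraph.awalk (with_proj G) u p v \<and> length p = n)"

definition subgraph_dist ::
  "'a pair_pre_digraph \<Rightarrow> 'a pair_pre_digraph \<Rightarrow> 'a pair_pre_digraph \<Rightarrow> nat" where
  "subgraph_dist G H1 H2 = Min {graph_dist G u v | u v. u \<in> pverts H1 \<and> v \<in> pverts H2}"

text \<open>
  Distance of the two elements of an unordered pair; well defined in a \<open>pair_graph\<close>
  because distance is symmetric, see \<open>pair_dist_doubleton\<close> below.
\<close>

definition pair_dist :: "'a pair_pre_digraph \<Rightarrow> 'a set \<Rightarrow> nat" where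
  "pair_dist G e = (THE d. \<exists>u v. e = {u, v} \<and> u \<noteq> v \<and> d = graph_dist G u v)"

lemma graph_dist_sym:
  assumes "pair_graph G"
  shows "graph_dist G u v = graph_dist G v u"
proof -
  interpret pair_graph G by fact
  have len: "length (rev_path p) = length p" for p :: "('a \<times> 'a) list"
    by (induction p) auto
  have *: "\<exists>p. awalk b p a \<and> length p = n"
    if walk: "\<exists>p. awalk a p b \<and> length p = n" for a b n
  proof -
    obtain p where "awalk a p b" "length p = n" using walk by blast
    then have "awalk b (rev_path p) a" "length (rev_path p) = n"
      using len by simp_all
    then show ?thesis by blast
  qed
  have "(\<exists>p. awalk u p v \<and> length p = n) \<longleftrightarrow> (\<exists>p. awalk v p u \<and> length p = n)" for n
    using *[of u v n] *[of v u n] by blast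
  then show ?thesis unfolding graph_dist_def by presburger
qed

lemma pair_dist_doubleton:
  assumes "pair_graph G" "u \<noteq> v"
  shows "pair_dist G {u, v} = graph_dist G u v"
  unfolding pair_dist_def
proof (rule the_equality)
  show "\<exists>a b. {u, v} = {a, b} \<and> a \<noteq> b \<and> graph_dist G u v = graph_dist G a b"
    using assms(2) by blast
next
  fix d assume "\<exists>a b. {u, v} = {a, b} \<and> a \<noteq> b \<and> d = graph_dist G a b"
  then show "d = graph_dist G u v"
    using graph_dist_sym[OF assms(1)] by (metis doubleton_eq_iff)
qed

subsection \<open>Hosoya polynomials\<close>

definition hosoya :: "'a pair_pre_digraph \<Rightarrow> int poly" where
  "hosoya G = (\<Sum>e \<in> {e. e \<subseteq> pverts G \<and> card e = 2}. monom 1 (pair_dist G e))"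

definition partial_hosoya :: "'a pair_pre_digraph \<Rightarrow> 'a \<Rightarrow> int poly" where
  "partial_hosoya G u = (\<Sum>v \<in> pverts G - {u}. monom 1 (graph_dist G u v))"

subsection \<open>Point-attaching\<close>

definition graph_image :: "('a \<Rightarrow> 'b) \<Rightarrow> 'a pair_pre_digraph \<Rightarrow> 'b pair_pre_digraph" where
  "graph_image f G = \<lparr> pverts = f ` pverts G, parcs = map_prod f f ` parcs G \<rparr>"

definition graph_union ::
  "'a pair_pre_digraph \<Rightarrow> 'a pair_pre_digraph \<Rightarrow> 'a pair_pre_digraph" where
  "graph_union G H = \<lparr> pverts = pverts G \<union> pverts H, parcs = parcs G \<union> parcs H \<rparr>"

text \<open>
  \<open>point_attaching f Gs G\<close>: the graph \<open>G\<close> arises by point-attaching from the pairwise disjoint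
  connected graphs in the list \<open>Gs\<close>, and \<open>f\<close> is the quotient map from the disjoint union of these
  graphs onto \<open>G\<close>, sending each vertex to the vertex of \<open>G\<close> it has become.
  In \<open>attach\<close>, \<open>H\<close> is the graph constructed so far and the vertices \<open>u\<close> of \<open>H\<close> and \<open>v\<close> of the new
  graph \<open>K\<close> are identified: \<open>f\<close> sends \<open>v\<close> to \<open>u\<close> and merges nothing else. The new vertices may have
  any names (even in another type), so \<open>G\<close> ranges over the whole isomorphism class of the result.
\<close>

inductive point_attaching ::
  "('a \<Rightarrow> 'b) \<Rightarrow> 'a pair_pre_digraph list \<Rightarrow> 'b pair_pre_digraph \<Rightarrow> bool"
  for f :: "'a \<Rightarrow> 'b" where
  single: "point_attaching f [K] (graph_image f K)"
    if "connected_graph K" "inj_on f (pverts K)"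
| attach: "point_attaching f (Gs @ [K]) (graph_union H (graph_image f K))"
    if "point_attaching f Gs H"
      and "connected_graph K" "\<forall>L \<in> set Gs. pverts L \<inter> pverts K = {}"
      and "u \<in> pverts H" "v \<in> pverts K"
      and "f v = u" "inj_on f (pverts K)" "f ` (pverts K - {v}) \<inter> pverts H = {}"

text \<open>The \<open>i\<close>-th graph regarded as a subgraph of the result (indices start at 0).\<close>

definition primary :: "('a \<Rightarrow> 'b) \<Rightarrow> 'a pair_pre_digraph list \<Rightarrow> nat \<Rightarrow> 'b pair_pre_digraph" where
  "primary f Gs i = graph_image f (Gs ! i)"

end

theory Submission
  imports Defs
begin

text \<open>
  If \<open>G\<close> arises from \<open>H\<close> and \<open>K\<close> by identifying a vertex \<open>u\<close>, then distances inside \<open>H\<close> and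
  inside \<open>K\<close> do not change and \<open>d(a, b) = d(a, u) + d(u, b)\<close> across the cut vertex; hence
  \<open>H(G) = H(H) + H(K) + H_u(H) H_u(K)\<close>. The rest of the argument only concerns the metric of the
  final graph. Every vertex \<open>w\<close> has a gate \<open>g\<close> in every primary subgraph \<open>S\<close>, i.e.
  \<open>d(w, v) = d(w, g) + d(g, v)\<close> for all \<open>v\<close> in \<open>S\<close>. The vertices \<open>v \<noteq> w\<close> are partitioned
  by the sets \<open>S - {g}\<close>, so \<open>H_w\<close> is the sum of \<open>t ^ d(w, g) H_g(S)\<close> over all \<open>S\<close>. For \<open>w = u\<close>, the
  attaching vertex of the next piece, the gates and \<open>u\<close> are the vertices realising the distances
  of that piece to the earlier ones, and substituting into the gluing formula gives the theorem
  by induction.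
\<close>

section \<open>Distances and relation powers\<close>

lemma pair_graph_iff:
  "pair_graph G \<longleftrightarrow> finite (pverts G) \<and> parcs G \<subseteq> pverts G \<times> pverts G \<and> sym (parcs G) \<and> irrefl (parcs G)"
proof
  assume "pair_graph G"
  then interpret pair_graph G .
  have "sym (parcs G)" using sym_arcs by (simp add: symmetric_def)
  then show "finite (pverts G) \<and> parcs G \<subseteq> pverts G \<times> pverts G \<and> sym (parcs G) \<and> irrefl (parcs G)"
    using pair_finite_verts in_arcsD1 in_arcsD2 pair_no_loops by (fastforce simp: irrefl_def)
next
  assume *: "finite (pverts G) \<and> parcs G \<subseteq> pverts G \<times> pverts G \<and> sym (parcs G) \<and> irrefl (parcs G)"
  then have "finite (parcs G)" by (meson finite_SigmaI finite_subset)
  with * show "pair_graph G"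
    by unfold_locales (auto simp: symmetric_def irrefl_def)
qed

lemma connected_graph_iff:
  "connected_graph G \<longleftrightarrow> pair_graph G \<and> pverts G \<noteq> {} \<and>
     (\<forall>u \<in> pverts G. \<forall>v \<in> pverts G. (u, v) \<in> (parcs G)\<^sup>*)"
proof (cases "pair_graph G")
  case True
  then interpret pair_graph G .
  have "sym (parcs G)" using sym_arcs by (simp add: symmetric_def)
  then have "(parcs G)\<^sup>s = parcs G"
    by (auto simp: symcl_def sym_conv_converse_eq)
  then have "Digraph_Component.connected (with_proj G) \<longleftrightarrow>
      pverts G \<noteq> {} \<and> (\<forall>u \<in> pverts G. \<forall>v \<in> pverts G. u \<rightarrow>\<^sup>*\<^bsub>with_proj G\<^esub> v)"
    by (simp add: connected_conv reachable_def)
  then show ?thesis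
    using True by (simp add: connected_graph_def reachable_conv)
qed (simp add: connected_graph_def)

text \<open>Relation powers let later proofs induct on a number instead of taking arc lists apart.
  The condition on \<open>u\<close> stays because the empty walk needs its vertex in the graph,
  while the zeroth power relates every point to itself.\<close>

lemma awalk_length_iff_relpow:
  assumes "parcs G \<subseteq> pverts G \<times> pverts G"
  shows "(\<exists>p. pre_digraph.awalk (with_proj G) u p v \<and> length p = n) \<longleftrightarrow>
    u \<in> pverts G \<and> (u, v) \<in> parcs G ^^ n"
proof -
  interpret pair_wf_digraph G using assms by unfold_locales auto
  show ?thesis
  proof (induction n arbitrary: u)
    case 0
    show ?case by (auto simp: awalk_Nil_iff)
  next
    case (Suc n)
    have "(\<exists>p. awalk u p v \<and> length p = Suc n) \<longleftrightarrow>
        (\<exists>w. (u, w) \<in> parcs G \<and> (\<exists>p. awalk w p v \<and> length p = n))"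
      (is "?L \<longleftrightarrow> ?R")
    proof
      assume ?L
      then obtain e p where "awalk u (e # p) v" "length p = n"
        by (auto simp: length_Suc_conv)
      then show ?R unfolding awalk_Cons_iff by (cases e) auto
    next
      assume ?R
      then obtain w p where "(u, w) \<in> parcs G" "awalk w p v" "length p = n" by blast
      then have "awalk u ((u, w) # p) v" "length ((u, w) # p) = Suc n"
        by (simp_all add: awalk_Cons_iff)
      then show ?L by blast
    qed
    also have "\<dots> \<longleftrightarrow> u \<in> pverts G \<and> (u, v) \<in> parcs G ^^ Suc n"
      \<comment> \<open>The power is unfolded at its last arc and commuted to its first one, where
        the walk was split.\<close>
      unfolding Suc.IH relpow.simps(2) relpow_commute[symmetric] using in_arcsD1 in_arcsD2 by blast
    finally show ?case .
  qed
qed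

lemma graph_dist_eq_Least_relpow:
  assumes "connected_graph G" "u \<in> pverts G"
  shows "graph_dist G u v = (LEAST n. (u, v) \<in> parcs G ^^ n)"
proof -
  have "parcs G \<subseteq> pverts G \<times> pverts G"
    using assms(1) by (simp add: connected_graph_iff pair_graph_iff)
  from awalk_length_iff_relpow[OF this] show ?thesis
    using assms(2) by (simp add: graph_dist_def)
qed

lemma graph_dist_le:
  assumes "connected_graph G" "u \<in> pverts G" "(u, v) \<in> parcs G ^^ n"
  shows "graph_dist G u v \<le> n"
  using assms by (simp add: graph_dist_eq_Least_relpow Least_le)

lemma relpow_graph_dist:
  assumes "connected_graph G" "u \<in> pverts G" "v \<in> pverts G"
  shows "(u, v) \<in> parcs G ^^ graph_dist G u v"
proof -
  have "(u, v) \<in> (parcs G)\<^sup>*" using assms by (simp add: connected_graph_iff)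
  then obtain n where "(u, v) \<in> parcs G ^^ n" by (auto simp: rtrancl_power)
  then show ?thesis
    unfolding graph_dist_eq_Least_relpow[OF assms(1,2)] by (rule LeastI)
qed

lemma graph_dist_self [simp]:
  assumes "connected_graph G" "u \<in> pverts G"
  shows "graph_dist G u u = 0"
  using graph_dist_le[OF assms, of u 0] by simp

lemma graph_dist_eq_0_iff:
  assumes "connected_graph G" "u \<in> pverts G" "v \<in> pverts G"
  shows "graph_dist G u v = 0 \<longleftrightarrow> u = v"
  using relpow_graph_dist[OF assms] assms by auto

lemma graph_dist_triangle:
  assumes "connected_graph G" "u \<in> pverts G" "v \<in> pverts G" "w \<in> pverts G"
  shows "graph_dist G u w \<le> graph_dist G u v + graph_dist G v w"
proof (rule graph_dist_le[OF assms(1,2)])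
  show "(u, w) \<in> parcs G ^^ (graph_dist G u v + graph_dist G v w)"
    unfolding relpow_add using relpow_graph_dist assms by (metis relcompI)
qed

lemma graph_dist_arc:
  assumes "connected_graph G" "w \<in> pverts G" "(a, b) \<in> parcs G"
  shows "graph_dist G w b \<le> graph_dist G w a + 1"
proof -
  have "a \<in> pverts G" using assms by (auto simp: connected_graph_iff pair_graph_iff)
  then have "(w, b) \<in> parcs G ^^ Suc (graph_dist G w a)"
    using relpow_graph_dist assms by (metis relpow_Suc_I)
  then show ?thesis using graph_dist_le[OF assms(1,2)] by fastforce
qed

text \<open>The source of lower bounds on distances: along a shortest walk \<open>h\<close> grows by
  at most one per arc. Exhibiting a suitable \<open>h\<close> replaces the analysis of arbitrary
  walks.\<close>

lemma lipschitz_le_graph_dist: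
  fixes h :: "'a \<Rightarrow> nat"
  assumes "connected_graph G" "u \<in> pverts G" "v \<in> pverts G"
    and step: "\<And>a b. (a, b) \<in> parcs G \<Longrightarrow> h b \<le> h a + 1"
  shows "h v \<le> h u + graph_dist G u v"
proof -
  have "h b \<le> h u + n" if "(u, b) \<in> parcs G ^^ n" for b n
    using that
  proof (induction n arbitrary: b)
    case (Suc n)
    then obtain a where "(u, a) \<in> parcs G ^^ n" "(a, b) \<in> parcs G" by auto
    then show ?case using Suc.IH[of a] step[of a b] by simp
  qed simp
  then show ?thesis using relpow_graph_dist[OF assms(1-3)] by blast
qed

lemma connected_graph_mono_dist:
  assumes "connected_graph G" "connected_graph H" "pverts H \<subseteq> pverts G" "parcs H \<subseteq> parcs G"
    and "a \<in> pverts H" "b \<in> pverts H"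
  shows "graph_dist G a b \<le> graph_dist H a b"
proof (rule graph_dist_le)
  have "parcs H ^^ n \<subseteq> parcs G ^^ n" for n
    using assms(4) by (induction n) auto
  then show "(a, b) \<in> parcs G ^^ graph_dist H a b"
    using relpow_graph_dist[OF assms(2,5,6)] by blast
qed (use assms in auto)

section \<open>Gluing graphs at a vertex\<close>

lemma pverts_graph_union [simp]: "pverts (graph_union H K) = pverts H \<union> pverts K"
  and parcs_graph_union [simp]: "parcs (graph_union H K) = parcs H \<union> parcs K"
  by (simp_all add: graph_union_def)

lemma graph_union_commute: "graph_union H K = graph_union K H"
  by (simp add: graph_union_def Un_commute)

lemma connected_graph_union:
  assumes "connected_graph H" "connected_graph K" "u \<in> pverts H" "u \<in> pverts K"
  shows "connected_graph (graph_union H K)"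
proof -
  let ?R = "(parcs H \<union> parcs K)\<^sup>*"
  have mono: "(parcs H)\<^sup>* \<subseteq> ?R" "(parcs K)\<^sup>* \<subseteq> ?R" by (auto intro!: rtrancl_mono)
  have "(a, u) \<in> ?R \<and> (u, a) \<in> ?R" if "a \<in> pverts H \<union> pverts K" for a
    using that assms mono by (auto simp: connected_graph_iff)
  then have "(a, b) \<in> ?R" if "a \<in> pverts H \<union> pverts K" "b \<in> pverts H \<union> pverts K" for a b
    using that by (meson rtrancl_trans)
  moreover have "pair_graph (graph_union H K)"
    using assms by (auto simp: connected_graph_iff pair_graph_iff irrefl_def intro: sym_Un)
  ultimately show ?thesis
    using assms(3) by (auto simp: connected_graph_iff)
qed

text \<open>No walk is cut at \<open>u\<close>. From above, walks of \<open>H\<close> and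
  \<open>K\<close> are walks of the union, and the triangle inequality joins them at
  \<open>u\<close>; from below, \<open>lipschitz_le_graph_dist\<close> applies to the expected
  distance.\<close>

lemma graph_dist_union:
  assumes H: "connected_graph H" and K: "connected_graph K"
    and u: "pverts H \<inter> pverts K = {u}" and a: "a \<in> pverts H"
  shows "b \<in> pverts H \<Longrightarrow> graph_dist (graph_union H K) a b = graph_dist H a b"
    and "b \<in> pverts K \<Longrightarrow> graph_dist (graph_union H K) a b = graph_dist H a u + graph_dist K u b"
proof -
  let ?G = "graph_union H K"
  have uH: "u \<in> pverts H" and uK: "u \<in> pverts K" using u by auto
  have G: "connected_graph ?G" using connected_graph_union[OF H K uH uK] .
  have HV: "parcs H \<subseteq> pverts H \<times> pverts H" and KV: "parcs K \<subseteq> pverts K \<times> pverts K"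
    using H K by (simp_all add: connected_graph_iff pair_graph_iff)
  \<comment> \<open>The expected distance from \<open>a\<close>; it grows by at most one along each arc,
    so it bounds the distance from below.\<close>
  define h where
    "h v = (if v \<in> pverts H then graph_dist H a v else graph_dist H a u + graph_dist K u v)" for v
  \<comment> \<open>At \<open>u\<close>, the only common vertex, both branches of \<open>h\<close>
    agree because \<open>u\<close> has distance 0 to itself in \<open>K\<close>. So the second
    formula holds on all of \<open>K\<close>, which settles arcs of \<open>K\<close> that touch
    \<open>u\<close>.\<close>
  have hK: "h v = graph_dist H a u + graph_dist K u v" if "v \<in> pverts K" for v
  proof (cases "v \<in> pverts H")
    case True
    then have "v = u" using that u by blast
    then show ?thesis using uH uK K by (simp add: h_def)
  qed (simp add: h_def)
  have "h c \<le> h b + 1" if "(b, c) \<in> parcs ?G" for b c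
  proof -
    from that consider "(b, c) \<in> parcs H" | "(b, c) \<in> parcs K" by auto
    then show ?thesis
    proof cases
      case 1
      then show ?thesis using HV graph_dist_arc[OF H a 1] by (auto simp: h_def)
    next
      case 2
      then have "b \<in> pverts K" "c \<in> pverts K" using KV by auto
      then show ?thesis using graph_dist_arc[OF K uK 2] by (simp add: hK)
    qed
  qed
  \<comment> \<open>The bound starts from \<open>h a = 0\<close>.\<close>
  then have lower: "h v \<le> graph_dist ?G a v" if "v \<in> pverts ?G" for v
    using lipschitz_le_graph_dist[OF G _ that, of a h] a H by (simp add: h_def)
  have upperH: "graph_dist ?G b c \<le> graph_dist H b c" if "b \<in> pverts H" "c \<in> pverts H" for b c
    using connected_graph_mono_dist[OF G H] that by simp
  have upperK: "graph_dist ?G b c \<le> graph_dist K b c" if "b \<in> pverts K" "c \<in> pverts K" for b c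
    using connected_graph_mono_dist[OF G K] that by simp
  show "graph_dist ?G a b = graph_dist H a b" if "b \<in> pverts H"
    using lower[of b] upperH[OF a that] that by (simp add: h_def)
  show "graph_dist ?G a b = graph_dist H a u + graph_dist K u b" if b: "b \<in> pverts K"
  proof -
    have "graph_dist ?G a b \<le> graph_dist ?G a u + graph_dist ?G u b"
      using graph_dist_triangle[OF G] a b uH by simp
    then show ?thesis
      using lower[of b] hK[OF b] upperH[OF a uH] upperK[OF uK b] b by simp
  qed
qed

section \<open>Injective images of graphs\<close>

lemma pverts_graph_image [simp]: "pverts (graph_image f K) = f ` pverts K"
  by (simp add: graph_image_def)

lemma connected_graph_image:
  assumes "connected_graph K" "inj_on f (pverts K)"
  shows "connected_graph (graph_image f K)"
proof -
  let ?R = "map_prod f f ` parcs K"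
  have K: "pair_graph K" and KV: "parcs K \<subseteq> pverts K \<times> pverts K"
    and s: "sym (parcs K)" and i: "irrefl (parcs K)"
    using assms(1) by (simp_all add: connected_graph_iff pair_graph_iff)
  have "sym ?R" using s by (force simp: sym_def)
  \<comment> \<open>A loop in the image would come from an arc whose ends \<open>f\<close> merges,
    which injectivity forbids.\<close>
  moreover have "irrefl ?R"
    using i KV inj_onD[OF assms(2)] by (fastforce simp: irrefl_def)
  ultimately have "pair_graph (graph_image f K)"
    using K KV by (auto simp: pair_graph_iff graph_image_def)
  moreover have "(f u, f v) \<in> ?R\<^sup>*" if "(u, v) \<in> (parcs K)\<^sup>*" for u v
    using that
  proof (induction rule: rtrancl_induct)
    case (step y z)
    then have "(f y, f z) \<in> ?R" by force
    with step.IH show ?case by (rule rtrancl_into_rtrancl)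
  qed simp
  ultimately show ?thesis
    using assms(1) by (auto simp: connected_graph_iff graph_image_def)
qed

section \<open>The metric structure of a point-attached graph\<close>

lemma primary_append:
  "i < length Gs \<Longrightarrow> primary f (Gs @ Ks) i = primary f Gs i"
  "primary f (Gs @ [K]) (length Gs) = graph_image f K"
  by (simp_all add: primary_def nth_append)

text \<open>What the counting argument retains of the construction. All cut conditions are stated in
  the metric of the final graph, so no intermediate graph is needed later.\<close>

locale tree_of_graphs =
  fixes G :: "'b pair_pre_digraph" and P :: "nat \<Rightarrow> 'b pair_pre_digraph" and m :: nat
  assumes connected_graph: "connected_graph G"
    and pverts_eq: "pverts G = (\<Union>i<m. pverts (P i))"
    and connected_piece: "i < m \<Longrightarrow> connected_graph (P i)"
    and graph_dist_piece: "i < m \<Longrightarrow> a \<in> pverts (P i) \<Longrightarrow> b \<in> pverts (P i) \<Longrightarrow>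
      graph_dist G a b = graph_dist (P i) a b"
    and cut_vertex: "0 < n \<Longrightarrow> n < m \<Longrightarrow>
      \<exists>u. (\<Union>i<n. pverts (P i)) \<inter> pverts (P n) = {u} \<and>
        (\<forall>a \<in> (\<Union>i<n. pverts (P i)). \<forall>b \<in> pverts (P n).
           graph_dist G a b = graph_dist G a u + graph_dist G u b)"

text \<open>By \<open>graph_dist_union\<close>, attaching a piece changes no distance inside the old
  graph or inside the piece. Hence the old cut conditions persist, and the only new cut vertex is
  the attaching vertex.\<close>

lemma point_attaching_tree_of_graphs:
  assumes "point_attaching f Gs G"
  shows "tree_of_graphs G (primary f Gs) (length Gs)"
  using assms
proof induction
  case (single K)
  then show ?case
    using connected_graph_image by unfold_locales (auto simp: primary_def)
next
  case (attach Gs H K u v)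
  let ?I = "graph_image f K" and ?P = "primary f Gs" and ?Q = "primary f (Gs @ [K])"
  let ?m = "length Gs" and ?G = "graph_union H (graph_image f K)"
  interpret H: tree_of_graphs H ?P ?m by fact
  note H = H.connected_graph and VH = H.pverts_eq
  have I: "connected_graph ?I" using connected_graph_image attach by blast
  have u: "pverts H \<inter> pverts ?I = {u}" using attach.hyps by auto
  then have uH: "u \<in> pverts H" and uI: "u \<in> pverts ?I" by auto
  have G: "connected_graph ?G" using connected_graph_union[OF H I uH uI] .
  note dH = graph_dist_union(1)[OF H I u]
  note dHI = graph_dist_union(2)[OF H I u]
  \<comment> \<open>The union is symmetric in its parts, so the same lemma with exchanged roles
    gives the distances inside the new piece.\<close>
  have u': "pverts ?I \<inter> pverts H = {u}" using u by blast
  have dI: "graph_dist ?G a b = graph_dist ?I a b" if "a \<in> pverts ?I" "b \<in> pverts ?I" for a b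
    using graph_dist_union(1)[OF I H u'] that by (simp add: graph_union_commute)
  have Q: "?Q i = ?P i" if "i < ?m" for i using that by (rule primary_append)
  have Qm: "?Q ?m = ?I" by (rule primary_append)
  have PH: "pverts (?P i) \<subseteq> pverts H" if "i < ?m" for i using VH that by blast
  have UQ: "(\<Union>i<n. pverts (?Q i)) = (\<Union>i<n. pverts (?P i))" if "n \<le> ?m" for n
    using that Q by (intro SUP_cong) auto
  have "pverts ?G = (\<Union>i<length (Gs @ [K]). pverts (?Q i))"
    using UQ[of ?m] VH by (simp add: lessThan_Suc Qm Un_commute)
  moreover have "connected_graph (?Q i) \<and> (\<forall>a \<in> pverts (?Q i). \<forall>b \<in> pverts (?Q i).
         graph_dist ?G a b = graph_dist (?Q i) a b)" if "i < length (Gs @ [K])" for i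
  proof (cases "i = ?m")
    case True
    then show ?thesis using Qm I dI by simp
  next
    case False
    then have i: "i < ?m" using that by simp
    show ?thesis unfolding Q[OF i] using H.connected_piece[OF i] dH H.graph_dist_piece[OF i] PH[OF i] by (simp add: subset_iff)
  qed
  moreover have "\<exists>u. (\<Union>i<n. pverts (?Q i)) \<inter> pverts (?Q n) = {u} \<and>
         (\<forall>a \<in> (\<Union>i<n. pverts (?Q i)). \<forall>b \<in> pverts (?Q n).
            graph_dist ?G a b = graph_dist ?G a u + graph_dist ?G u b)"
    if n: "0 < n" "n < length (Gs @ [K])" for n
  proof (cases "n = ?m")
    case True
    have "graph_dist ?G a b = graph_dist ?G a u + graph_dist ?G u b"
      if "a \<in> pverts H" "b \<in> pverts ?I" for a b
      using dHI[OF that] dH[OF that(1) uH] dI[OF uI that(2)] by simp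
    then show ?thesis
      unfolding True Qm UQ[OF order_refl] VH[symmetric] using u by blast
  next
    case False
    then have n': "n < ?m" using n by simp
    \<comment> \<open>For an older piece the cut vertex and both end points lie in \<open>H\<close>,
      so additivity transfers from \<open>H\<close>.\<close>
    have sub: "(\<Union>i<n. pverts (?P i)) \<subseteq> pverts H" by (intro UN_least PH) (use n' in auto)
    from H.cut_vertex[OF n(1) n'] obtain w where w: "(\<Union>i<n. pverts (?P i)) \<inter> pverts (?P n) = {w}"
      and add: "\<And>a b. a \<in> (\<Union>i<n. pverts (?P i)) \<Longrightarrow> b \<in> pverts (?P n) \<Longrightarrow>
            graph_dist H a b = graph_dist H a w + graph_dist H w b" by blast
    have wH: "w \<in> pverts H" using w sub by blast
    have "graph_dist ?G a b = graph_dist ?G a w + graph_dist ?G w b"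
      if "a \<in> (\<Union>i<n. pverts (?P i))" "b \<in> pverts (?P n)" for a b
    proof -
      have "a \<in> pverts H" "b \<in> pverts H" using that sub PH[OF n'] by auto
      then show ?thesis using add[OF that] dH wH by simp
    qed
    then show ?thesis
      unfolding Q[OF n'] UQ[OF less_imp_le[OF n']] using w by blast
  qed
  ultimately show ?case using G by unfold_locales auto
qed

section \<open>Gates\<close>

text \<open>Form of \<open>partial_hosoya\<close> for a bare distance function and a vertex set, so
  that all pieces can share the metric of the whole graph.\<close>

definition dist_sum :: "('b \<Rightarrow> 'b \<Rightarrow> nat) \<Rightarrow> 'b set \<Rightarrow> 'b \<Rightarrow> int poly" where
  "dist_sum d A w = (\<Sum>v \<in> A - {w}. monom 1 (d w v))"

text \<open>The notion from gated sets in metric graph theory; \<open>p\<close> is a point of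
  \<open>A\<close> nearest to \<open>w\<close>.\<close>

definition is_gate :: "('b \<Rightarrow> 'b \<Rightarrow> nat) \<Rightarrow> 'b set \<Rightarrow> 'b \<Rightarrow> 'b \<Rightarrow> bool" where
  "is_gate d A w p \<longleftrightarrow> p \<in> A \<and> (\<forall>v \<in> A. d w v = d w p + d p v)"

lemma is_gateD:
  assumes "is_gate d A w p"
  shows "p \<in> A" "v \<in> A \<Longrightarrow> d w v = d w p + d p v"
  using assms unfolding is_gate_def by blast+

section \<open>Sums over unordered pairs\<close>

definition pair_sum :: "('b set \<Rightarrow> nat) \<Rightarrow> 'b set \<Rightarrow> int poly" where
  "pair_sum D A = (\<Sum>e \<in> {e. e \<subseteq> A \<and> card e = 2}. monom 1 (D e))"

text \<open>A pair lies in \<open>A\<close>, lies in \<open>B\<close>, or joins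
  \<open>A - {u}\<close> to \<open>B - {u}\<close>. No pair is of two kinds, as the sets share a
  single point. For the third kind the exponent is a sum, so the double sum factors.\<close>

lemma pair_sum_glue:
  assumes "finite A" "finite B" "A \<inter> B = {u}"
    and D: "\<And>a b. a \<in> A - {u} \<Longrightarrow> b \<in> B - {u} \<Longrightarrow> D {a, b} = d u a + d u b"
  shows "pair_sum D (A \<union> B) = pair_sum D A + pair_sum D B + dist_sum d A u * dist_sum d B u"
proof -
  let ?E = "\<lambda>A. {e. e \<subseteq> A \<and> card e = 2}"
  let ?f = "\<lambda>(a, b). {a, b}"
  let ?X = "(A - {u}) \<times> (B - {u})"
  have disj: "a \<noteq> b" "a \<notin> B" "b \<notin> A" if "a \<in> A - {u}" "b \<in> B - {u}" for a b
    using that assms(3) by blast+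
  have inj: "inj_on ?f ?X"
  proof (rule inj_onI)
    fix p q assume pq: "p \<in> ?X" "q \<in> ?X" "?f p = ?f q"
    obtain a b a' b' where ab: "p = (a, b)" "q = (a', b')" by fastforce
    \<comment> \<open>Excludes that equal doubletons match crosswise.\<close>
    then have "a \<noteq> b'" using disj(1)[of a b'] pq by simp
    with pq(3) show "p = q" by (auto simp: ab doubleton_eq_iff)
  qed
  have split: "?E (A \<union> B) = ?E A \<union> ?E B \<union> ?f ` ?X"
  proof (intro equalityI subsetI)
    fix e assume "e \<in> ?E (A \<union> B)"
    then obtain a b where e: "e = {a, b}" "a \<noteq> b" "a \<in> A \<union> B" "b \<in> A \<union> B"
      by (auto simp: card_2_iff)
    consider "e \<subseteq> A" | "e \<subseteq> B" | "a \<in> A - B" "b \<in> B - A" | "b \<in> A - B" "a \<in> B - A"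
      using e by blast
    then show "e \<in> ?E A \<union> ?E B \<union> ?f ` ?X"
    proof cases
      case 3
      then have "(a, b) \<in> ?X" using assms(3) by auto
      then show ?thesis using e(1) by (auto intro: rev_image_eqI)
    next
      case 4
      then have "(b, a) \<in> ?X" using assms(3) by auto
      then show ?thesis using e(1) by (auto intro: rev_image_eqI)
    qed (use \<open>e \<in> ?E (A \<union> B)\<close> in auto)
  next
    fix e assume "e \<in> ?E A \<union> ?E B \<union> ?f ` ?X"
    then consider "e \<in> ?E A \<union> ?E B" | a b where "a \<in> A - {u}" "b \<in> B - {u}" "e = {a, b}"
      by blast
    then show "e \<in> ?E (A \<union> B)"
    proof cases
      case 2
      then show ?thesis using disj(1)[of a b] by auto
    qed auto
  qed
  have fin: "finite (?E A)" "finite (?E B)" "finite (?f ` ?X)" using assms(1,2) by auto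
  have AB: "?E A \<inter> ?E B = {}"
  proof (rule equals0I)
    fix e assume "e \<in> ?E A \<inter> ?E B"
    then have "e \<subseteq> {u}" "card e = 2" using assms(3) by blast+
    then show False using card_mono[of "{u}" e] by simp
  qed
  have ABX: "(?E A \<union> ?E B) \<inter> ?f ` ?X = {}"
  proof (rule equals0I)
    fix e assume "e \<in> (?E A \<union> ?E B) \<inter> ?f ` ?X"
    then obtain a b where "a \<in> A - {u}" "b \<in> B - {u}" "e = {a, b}" "e \<subseteq> A \<or> e \<subseteq> B" by blast
    then show False using disj[of a b] by simp
  qed
  have "(\<Sum>e \<in> ?f ` ?X. monom (1::int) (D e)) = (\<Sum>(a, b) \<in> ?X. monom 1 (d u a) * monom 1 (d u b))"
    unfolding sum.reindex[OF inj] by (intro sum.cong) (simp_all add: D mult_monom split_beta mem_Times_iff)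
  also have "\<dots> = dist_sum d A u * dist_sum d B u"
    by (simp add: dist_sum_def sum_product sum.cartesian_product)
  finally have cross:
    "(\<Sum>e \<in> ?f ` ?X. monom (1::int) (D e)) = dist_sum d A u * dist_sum d B u" .
  show ?thesis
    unfolding pair_sum_def split sum.union_disjoint[OF finite_UnI[OF fin(1,2)] fin(3) ABX]
      sum.union_disjoint[OF fin(1,2) AB] cross ..
qed

text \<open>The metric core of \<open>tree_of_graphs\<close>, with the cut vertices named by
  \<open>c\<close>. The first piece has no predecessors, so \<open>c 0\<close> is arbitrary.\<close>

locale tree_of_pieces =
  fixes d :: "'b \<Rightarrow> 'b \<Rightarrow> nat" and S :: "nat \<Rightarrow> 'b set" and c :: "nat \<Rightarrow> 'b" and k :: nat
  assumes finite_piece: "\<And>i. i < k \<Longrightarrow> finite (S i)"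
    and d_sym: "\<And>a b. d a b = d b a"
    and d_eq_0_iff: "\<And>i j a b. i < k \<Longrightarrow> j < k \<Longrightarrow> a \<in> S i \<Longrightarrow> b \<in> S j \<Longrightarrow> d a b = 0 \<longleftrightarrow> a = b"
    and cut_vertex: "\<And>n. 0 < n \<Longrightarrow> n < k \<Longrightarrow> (\<Union>i<n. S i) \<inter> S n = {c n}"
    and d_cut: "\<And>n a b. 0 < n \<Longrightarrow> n < k \<Longrightarrow> a \<in> (\<Union>i<n. S i) \<Longrightarrow> b \<in> S n \<Longrightarrow>
      d a b = d a (c n) + d (c n) b"
begin

abbreviation V :: "nat \<Rightarrow> 'b set" where "V n \<equiv> (\<Union>i<n. S i)"

lemma cut_in: "0 < n \<Longrightarrow> n < k \<Longrightarrow> c n \<in> V n" "0 < n \<Longrightarrow> n < k \<Longrightarrow> c n \<in> S n"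
  using cut_vertex by blast+

lemma V_Suc: "V (Suc n) = V n \<union> S n"
  by (simp add: lessThan_Suc Un_commute)

lemma finite_V: "n \<le> k \<Longrightarrow> finite (V n)"
  using finite_piece by auto

lemma d_self: "i < k \<Longrightarrow> a \<in> S i \<Longrightarrow> d a a = 0"
  using d_eq_0_iff by simp

text \<open>Induction on the number of pieces. If \<open>w\<close> lies in an earlier piece, its
  gate in the new piece is \<open>c n\<close>. Otherwise every distance from \<open>w\<close> to the
  earlier pieces splits at \<open>c n\<close>, so the gates of \<open>c n\<close> also serve
  \<open>w\<close>; this needs the induction hypothesis at \<open>c n\<close> instead of
  \<open>w\<close>.\<close>

lemma gates:
  assumes "0 < n" "n \<le> k" "w \<in> V n"
  shows "\<exists>g. (\<forall>i<n. is_gate d (S i) w (g i)) \<and>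
    dist_sum d (V n) w = (\<Sum>i<n. monom 1 (d w (g i)) * dist_sum d (S i) (g i))"
  using assms
proof (induction n arbitrary: w rule: nat_induct_non_zero)
  case 1
  then have w: "w \<in> S 0" "0 < k" by auto
  \<comment> \<open>The start vertex is its own gate, so the factor of its piece is
    \<open>monom 1 0 = 1\<close>.\<close>
  then have "d w w = 0" using d_self by blast
  moreover have "V (Suc 0) = S 0" by (simp add: lessThan_Suc)
  ultimately show ?case
    using w by (intro exI[of _ "\<lambda>_. w"]) (simp add: is_gate_def flip: one_poly_eq_simps(1) monom_0)
next
  case (Suc n)
  have n: "0 < n" "n < k" "n \<le> k" using Suc by auto
  note cV = cut_in(1)[OF n(1,2)] and cS = cut_in(2)[OF n(1,2)]
  have int: "V n \<inter> S n = {c n}" using cut_vertex n by blast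
  have fin: "finite (V n)" "finite (S n)" using finite_V finite_piece n by auto
  show ?case
  proof (cases "w \<in> V n")
    case True
    obtain g where g: "\<forall>i<n. is_gate d (S i) w (g i)"
      "dist_sum d (V n) w = (\<Sum>i<n. monom 1 (d w (g i)) * dist_sum d (S i) (g i))"
      using Suc.IH[OF n(3) True] by blast
    let ?g = "g(n := c n)"
    \<comment> \<open>The shared vertex \<open>c n\<close> is counted with \<open>V n\<close>; if it
      equals \<open>w\<close>, neither part contains it.\<close>
    have "V (Suc n) - {w} = (V n - {w}) \<union> (S n - {c n})"
      using int True cV by (auto simp: V_Suc)
    moreover have "(V n - {w}) \<inter> (S n - {c n}) = {}" using int by blast
    ultimately have "dist_sum d (V (Suc n)) w =
        dist_sum d (V n) w + (\<Sum>v \<in> S n - {c n}. monom 1 (d w v))"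
      unfolding dist_sum_def using fin by (simp only: sum.union_disjoint finite_Diff)
    also have "(\<Sum>v \<in> S n - {c n}. monom (1::int) (d w v)) =
        monom 1 (d w (c n)) * dist_sum d (S n) (c n)"
      unfolding dist_sum_def sum_distrib_left
      using d_cut[OF n(1,2) True] by (intro sum.cong) (auto simp: mult_monom)
    finally have "dist_sum d (V (Suc n)) w =
        (\<Sum>i<Suc n. monom 1 (d w (?g i)) * dist_sum d (S i) (?g i))"
      by (simp add: g(2))
    moreover have "is_gate d (S n) w (c n)"
      unfolding is_gate_def using d_cut[OF n(1,2) True] cS by blast
    then have "\<forall>i<Suc n. is_gate d (S i) w (?g i)"
      using g(1) by (simp add: less_Suc_eq)
    ultimately show ?thesis by blast
  next
    case False
    then have w: "w \<in> S n" using Suc.prems by (auto simp: V_Suc)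
    have dw: "d w v = d w (c n) + d (c n) v" if "v \<in> V n" for v
      using d_cut[OF n(1,2) that w] d_sym by simp
    obtain g where g: "\<forall>i<n. is_gate d (S i) (c n) (g i)"
      "dist_sum d (V n) (c n) = (\<Sum>i<n. monom 1 (d (c n) (g i)) * dist_sum d (S i) (g i))"
      using Suc.IH[OF n(3) cV] by blast
    \<comment> \<open>Since \<open>g i\<close> lies in \<open>V n\<close>, \<open>dw\<close> applies
      to it and merges the exponents \<open>d w (c n)\<close> and \<open>d (c n) (g i)\<close> into
      \<open>d w (g i)\<close>.\<close>
    have gV: "g i \<in> V n" if "i < n" for i
      using is_gateD(1)[OF g(1)[rule_format, OF that]] that by blast
    let ?g = "g(n := w)"
    \<comment> \<open>Now \<open>c n\<close> differs from \<open>w\<close> and is counted with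
      \<open>S n\<close>.\<close>
    have "V (Suc n) - {w} = (S n - {w}) \<union> (V n - {c n})"
      using False int by (auto simp: V_Suc)
    moreover have "(S n - {w}) \<inter> (V n - {c n}) = {}" using int by blast
    ultimately have "dist_sum d (V (Suc n)) w =
        dist_sum d (S n) w + (\<Sum>v \<in> V n - {c n}. monom 1 (d w v))"
      unfolding dist_sum_def using fin by (simp only: sum.union_disjoint finite_Diff)
    also have "(\<Sum>v \<in> V n - {c n}. monom (1::int) (d w v)) =
        monom 1 (d w (c n)) * dist_sum d (V n) (c n)"
      unfolding dist_sum_def sum_distrib_left
      using dw by (intro sum.cong) (auto simp: mult_monom)
    also have "\<dots> = (\<Sum>i<n. monom 1 (d w (g i)) * dist_sum d (S i) (g i))"
      unfolding g(2) sum_distrib_left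
      using dw[OF gV] by (intro sum.cong) (auto simp: mult_monom mult.assoc[symmetric])
    finally have sum: "dist_sum d (V (Suc n)) w =
        (\<Sum>i<Suc n. monom 1 (d w (?g i)) * dist_sum d (S i) (?g i))"
      using d_self[OF n(2) w] by (simp add: add.commute)
    have "is_gate d (S i) w (g i)" if "i < n" for i
    proof -
      have gate: "d (c n) v = d (c n) (g i) + d (g i) v" if "v \<in> S i" for v
        using is_gateD(2)[OF g(1)[rule_format, OF \<open>i < n\<close>] that] .
      have "d w v = d w (g i) + d (g i) v" if "v \<in> S i" for v
      proof -
        have "v \<in> V n" using that \<open>i < n\<close> by blast
        then show ?thesis
          using dw[of v] dw[OF gV[OF \<open>i < n\<close>]] gate[OF that] by simp
      qed
      then show ?thesis using g(1) that unfolding is_gate_def by blast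
    qed
    moreover have "is_gate d (S n) w w"
      using w d_self[OF n(2) w] by (simp add: is_gate_def)
    ultimately have "\<forall>i<Suc n. is_gate d (S i) w (?g i)"
      by (simp add: less_Suc_eq)
    with sum show ?thesis by blast
  qed
qed

text \<open>The distance splits at \<open>c j\<close>, where the later piece is entered, and then at
  \<open>p\<close>, the gate of \<open>c j\<close> in the earlier piece.\<close>

lemma d_between_pieces:
  assumes "i < j" "j < k" "is_gate d (S i) (c j) p" "a \<in> S i" "b \<in> S j"
  shows "d a b = d p (c j) + d a p + d (c j) b"
proof -
  have "a \<in> V j" using assms by blast
  then have "d a b = d a (c j) + d (c j) b" using d_cut[of j a b] assms by simp
  moreover have "d (c j) a = d (c j) p + d p a" using is_gateD(2)[OF assms(3,4)] .
  ultimately show ?thesis by (simp add: d_sym)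
qed

text \<open>The excess of \<open>d a b\<close> over \<open>d p (c j)\<close> is
  \<open>d a p + d (c j) b\<close>, so both terms vanish. The inequality form allows use for a
  minimum not yet known to equal \<open>d p (c j)\<close>.\<close>

lemma nearest_pair_unique:
  assumes "i < j" "j < k" "is_gate d (S i) (c j) p" "a \<in> S i" "b \<in> S j" "d a b \<le> d p (c j)"
  shows "a = p" "b = c j"
proof -
  have p: "p \<in> S i" using assms by (simp add: is_gate_def)
  have c: "c j \<in> S j" using cut_in assms by auto
  have "d a p = 0" "d (c j) b = 0"
    using d_between_pieces[OF assms(1-5)] assms(6) by auto
  then show "a = p" "b = c j"
    using d_eq_0_iff[of i i a p] d_eq_0_iff[of j j "c j" b] assms p c by auto
qed

text \<open>The pieces are glued in order. Attaching \<open>S n\<close> adds the product of two sums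
  based at \<open>c n\<close>; \<open>gates\<close> expands the one over \<open>V n\<close> into one
  term for each \<open>i < n\<close>. Thus pairs of pieces are grouped by their larger
  index.\<close>

lemma pair_sum_V:
  fixes x :: "nat \<Rightarrow> nat \<Rightarrow> 'b" and \<delta> :: "nat \<Rightarrow> nat \<Rightarrow> nat"
  assumes D: "\<And>a b. a \<noteq> b \<Longrightarrow> D {a, b} = d a b"
    and x: "\<And>i j. i < j \<Longrightarrow> j < k \<Longrightarrow>
      is_gate d (S i) (c j) (x i j) \<and> x j i = c j \<and> \<delta> i j = d (x i j) (c j)"
    and "n \<le> k"
  shows "pair_sum D (V n) = (\<Sum>i<n. pair_sum D (S i)) +
    (\<Sum>j<n. \<Sum>i<j. dist_sum d (S i) (x i j) * dist_sum d (S j) (x j i) * monom 1 (\<delta> i j))"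
  using \<open>n \<le> k\<close>
proof (induction n)
  case 0
  have "pair_sum D {} = 0" unfolding pair_sum_def by (intro sum.neutral) auto
  then show ?case by simp
next
  case (Suc n)
  show ?case
  proof (cases "n = 0")
    \<comment> \<open>The first piece is glued to nothing and has no cut vertex.\<close>
    case True
    then show ?thesis by (simp add: lessThan_Suc)
  next
    case False
    then have n: "0 < n" "n < k" "n \<le> k" using Suc by auto
    have int: "V n \<inter> S n = {c n}" using cut_vertex n by blast
    have fin: "finite (V n)" "finite (S n)" using finite_V finite_piece n by auto
    obtain g where g: "\<forall>i<n. is_gate d (S i) (c n) (g i)"
      "dist_sum d (V n) (c n) = (\<Sum>i<n. monom 1 (d (c n) (g i)) * dist_sum d (S i) (g i))"
      using gates[OF n(1,3) cut_in(1)[OF n(1,2)]] by blast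
    \<comment> \<open>Gates are unique: applying each gate equation to the other gate and adding
      forces their distance to be 0.\<close>
    have gx: "g i = x i n" if "i < n" for i
    proof -
      have x': "is_gate d (S i) (c n) (x i n)" and g': "is_gate d (S i) (c n) (g i)"
        using x[OF that n(2)] g(1) that by simp_all
      note xi = is_gateD(1)[OF x'] and gi = is_gateD(1)[OF g']
      have "d (g i) (x i n) = 0"
        using is_gateD(2)[OF x' gi] is_gateD(2)[OF g' xi] by simp
      then show ?thesis using d_eq_0_iff[of i i] gi xi that n by simp
    qed
    have "dist_sum d (V n) (c n) * dist_sum d (S n) (c n) =
        (\<Sum>i<n. dist_sum d (S i) (x i n) * dist_sum d (S n) (x n i) * monom 1 (\<delta> i n))"
      unfolding g(2) sum_distrib_right
      using x n gx d_sym by (intro sum.cong) (auto simp: mult_ac)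
    moreover have "pair_sum D (V n \<union> S n) =
        pair_sum D (V n) + pair_sum D (S n) + dist_sum d (V n) (c n) * dist_sum d (S n) (c n)"
    proof (rule pair_sum_glue[OF fin int])
      fix a b assume ab: "a \<in> V n - {c n}" "b \<in> S n - {c n}"
      then have "a \<noteq> b" using int by blast
      then show "D {a, b} = d (c n) a + d (c n) b"
        using D[of a b] d_cut[OF n(1,2), of a b] ab d_sym[of a "c n"] by auto
    qed
    ultimately show ?thesis using Suc.IH n by (simp add: V_Suc algebra_simps)
  qed
qed

end

theorem theorem1:
  fixes Gs :: "'a pair_pre_digraph list" and G :: "'b pair_pre_digraph"
    and f :: "'a \<Rightarrow> 'b" and x :: "nat \<Rightarrow> nat \<Rightarrow> 'b"
    and P :: "nat \<Rightarrow> 'b pair_pre_digraph" and \<delta> :: "nat \<Rightarrow> nat \<Rightarrow> nat" and k :: nat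
  assumes "connected_graph G"
    and "point_attaching f Gs G"
    and "k = length Gs"
    and "P = primary f Gs"
    and "\<delta> = (\<lambda>i j. subgraph_dist G (P i) (P j))"
    and "\<And>i j. i < k \<Longrightarrow> j < k \<Longrightarrow> i \<noteq> j \<Longrightarrow>
           x i j \<in> pverts (P i) \<and> graph_dist G (x i j) (x j i) = \<delta> i j"
  shows "(\<forall>i<k. \<forall>j<k. i \<noteq> j \<longrightarrow>
            (\<exists>!p. p \<in> pverts (P i) \<times> pverts (P j) \<and> graph_dist G (fst p) (snd p) = \<delta> i j)) \<and>
         hosoya G = (\<Sum>i<k. hosoya (P i)) +
           (\<Sum>(i, j) \<in> {(i, j). i < j \<and> j < k}.
              partial_hosoya (P i) (x i j) * partial_hosoya (P j) (x j i) * monom 1 (\<delta> i j))"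
proof -
  let ?S = "\<lambda>i. pverts (P i)" and ?d = "graph_dist G" and ?V = "\<lambda>n. \<Union>i<n. pverts (P i)"
  interpret T: tree_of_graphs G P k
    using point_attaching_tree_of_graphs[OF assms(2)] assms(3,4) by simp
  note G = T.connected_graph and VG = T.pverts_eq and conn = T.connected_piece
    and dP = T.graph_dist_piece
  have pG: "pair_graph G" using G by (simp add: connected_graph_iff)
  note dsym = graph_dist_sym[OF pG]
  obtain c where c: "\<And>n. 0 < n \<Longrightarrow> n < k \<Longrightarrow> ?V n \<inter> ?S n = {c n}"
    "\<And>n a b. 0 < n \<Longrightarrow> n < k \<Longrightarrow> a \<in> ?V n \<Longrightarrow> b \<in> ?S n \<Longrightarrow> ?d a b = ?d a (c n) + ?d (c n) b"
  proof -
    \<comment> \<open>The range condition stands under the existential so that \<open>choice\<close>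
      yields a total function.\<close>
    have "\<forall>n. \<exists>u. 0 < n \<and> n < k \<longrightarrow> ?V n \<inter> ?S n = {u} \<and>
        (\<forall>a \<in> ?V n. \<forall>b \<in> ?S n. ?d a b = ?d a u + ?d u b)"
      using T.cut_vertex by presburger
    from choice[OF this] show thesis using that by blast
  qed
  have SG: "?S i \<subseteq> pverts G" if "i < k" for i using VG that by blast
  interpret tree_of_pieces ?d ?S c k
  proof
    show "finite (?S i)" if "i < k" for i
      using conn[OF that] by (simp add: connected_graph_iff pair_graph_iff)
    show "?d a b = 0 \<longleftrightarrow> a = b" if "i < k" "j < k" "a \<in> ?S i" "b \<in> ?S j" for i j a b
      using graph_dist_eq_0_iff[OF G subsetD[OF SG] subsetD[OF SG], of i a j b] that by simp
    show "?d a b = ?d b a" for a b by (rule dsym)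
    show "?V n \<inter> ?S n = {c n}" if "0 < n" "n < k" for n by (rule c(1)[OF that])
    show "?d a b = ?d a (c n) + ?d (c n) b"
      if "0 < n" "n < k" "a \<in> ?V n" "b \<in> ?S n" for n a b by (rule c(2)[OF that])
  qed
  \<comment> \<open>Identifies the given \<open>x\<close> and \<delta> with gate data. The minimum
    gives only \<delta> at most \<open>?d p (c j)\<close>; as the given pair attains \<delta>, it
    must be \<open>p\<close> and \<open>c j\<close>, which also gives equality.\<close>
  have bridge: "is_gate ?d (?S i) (c j) (x i j) \<and> x j i = c j \<and> \<delta> i j = ?d (x i j) (c j)"
    if ij: "i < j" "j < k" for i j
  proof -
    have j: "0 < j" "j \<le> k" "i < k" using ij by auto
    obtain p where p: "is_gate ?d (?S i) (c j) p"
      using gates[OF j(1,2) cut_in(1)[OF j(1) ij(2)]] ij(1) by blast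
    have pS: "p \<in> ?S i" and cS: "c j \<in> ?S j"
      using is_gateD(1)[OF p] cut_in(2)[OF j(1) ij(2)] by blast+
    have "\<delta> i j \<le> ?d p (c j)"
      unfolding assms(5) subgraph_dist_def
    proof (rule Min_le)
      have "{?d u v |u v. u \<in> ?S i \<and> v \<in> ?S j} = (\<lambda>(u, v). ?d u v) ` (?S i \<times> ?S j)" by auto
      then show "finite {?d u v |u v. u \<in> ?S i \<and> v \<in> ?S j}"
        using finite_piece ij j by simp
      show "?d p (c j) \<in> {?d u v |u v. u \<in> ?S i \<and> v \<in> ?S j}" using pS cS by blast
    qed
    then have uniq: "a = p \<and> b = c j" if "a \<in> ?S i" "b \<in> ?S j" "?d a b = \<delta> i j" for a b
      using nearest_pair_unique[OF ij p that(1,2)] that(3) by simp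
    have x: "x i j \<in> ?S i" "x j i \<in> ?S j" "?d (x i j) (x j i) = \<delta> i j"
      using assms(6)[of i j] assms(6)[of j i] ij j by auto
    have eq: "x i j = p" "x j i = c j" using uniq[OF x] by simp_all
    show ?thesis unfolding eq using p x(3)[unfolded eq] by simp
  qed
  have nearest: "a = x i j \<and> b = x j i"
    if ij: "i < j" "j < k" and ab: "a \<in> ?S i" "b \<in> ?S j" "?d a b = \<delta> i j" for i j a b
  proof -
    have gate: "is_gate ?d (?S i) (c j) (x i j)" and eq: "x j i = c j" "\<delta> i j = ?d (x i j) (c j)"
      using bridge[OF ij] by simp_all
    show ?thesis
      unfolding eq(1) using nearest_pair_unique[OF ij gate ab(1,2)] ab(3) eq(2) by simp
  qed
  \<comment> \<open>Symmetry reduces uniqueness for arbitrary distinct indices to the case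
    \<open>i < j\<close>.\<close>
  have dsym': "\<delta> i j = \<delta> j i" for i j
    unfolding assms(5) subgraph_dist_def
    by (rule arg_cong[where f = Min]) (use dsym in blast)
  have uniq: "a = x i j \<and> b = x j i"
    if ij: "i < k" "j < k" "i \<noteq> j" and ab: "a \<in> ?S i" "b \<in> ?S j" "?d a b = \<delta> i j" for i j a b
  proof (cases "i < j")
    case True
    then show ?thesis using nearest ij(2) ab by simp
  next
    case False
    then have "j < i" using ij by simp
    moreover have "?d b a = \<delta> j i" by (simp only: ab(3) dsym[of b a] dsym'[of j i])
    ultimately show ?thesis using nearest[of j i b a] ij(1) ab(1,2) by simp
  qed
  have "\<exists>!p. p \<in> ?S i \<times> ?S j \<and> ?d (fst p) (snd p) = \<delta> i j"
    if ij: "i < k" "j < k" "i \<noteq> j" for i j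
  proof (rule ex1I[of _ "(x i j, x j i)"])
    show "(x i j, x j i) \<in> ?S i \<times> ?S j \<and> ?d (fst (x i j, x j i)) (snd (x i j, x j i)) = \<delta> i j"
      using assms(6)[of i j] assms(6)[of j i] ij by auto
  qed (use uniq[OF ij] in auto)
  moreover have "hosoya G = (\<Sum>i<k. hosoya (P i)) +
           (\<Sum>(i, j) \<in> {(i, j). i < j \<and> j < k}.
              partial_hosoya (P i) (x i j) * partial_hosoya (P j) (x j i) * monom 1 (\<delta> i j))"
  proof -
    \<comment> \<open>Pieces keep their distances in \<open>G\<close>, so sums in the common metric
      are the Hosoya polynomials of the pieces.\<close>
    have hP: "pair_sum (pair_dist G) (?S i) = hosoya (P i)" if "i < k" for i
    proof -
      have "pair_dist G e = pair_dist (P i) e" if e: "e \<subseteq> ?S i" "card e = 2" for e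
      proof -
        obtain a b where ab: "e = {a, b}" "a \<noteq> b" using e(2) by (auto simp: card_2_iff)
        have "pair_graph (P i)" using conn[OF \<open>i < k\<close>] by (simp add: connected_graph_iff)
        then show ?thesis
          using pair_dist_doubleton[OF _ ab(2)] pG dP[OF \<open>i < k\<close>, of a b] e(1) ab(1) by simp
      qed
      then show ?thesis unfolding pair_sum_def hosoya_def by (intro sum.cong) auto
    qed
    have hS: "dist_sum ?d (?S i) (x i j) = partial_hosoya (P i) (x i j)"
      if "i < k" "j < k" "i \<noteq> j" for i j
      unfolding dist_sum_def partial_hosoya_def
      using dP[OF that(1)] assms(6)[OF that] by (intro sum.cong) auto
    have "hosoya G = pair_sum (pair_dist G) (?V k)"
      by (simp add: hosoya_def pair_sum_def VG)
    also have "\<dots> = (\<Sum>i<k. pair_sum (pair_dist G) (?S i)) + (\<Sum>j<k. \<Sum>i<j.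
        dist_sum ?d (?S i) (x i j) * dist_sum ?d (?S j) (x j i) * monom 1 (\<delta> i j))"
      by (rule pair_sum_V) (use bridge pair_dist_doubleton[OF pG] in auto)
    also have "\<dots> = (\<Sum>i<k. hosoya (P i)) + (\<Sum>j<k. \<Sum>i<j.
        partial_hosoya (P i) (x i j) * partial_hosoya (P j) (x j i) * monom 1 (\<delta> i j))"
      using hP hS by simp
    also have "(\<Sum>j<k. \<Sum>i<j.
        partial_hosoya (P i) (x i j) * partial_hosoya (P j) (x j i) * monom 1 (\<delta> i j)) =
      (\<Sum>(i, j) \<in> {(i, j). i < j \<and> j < k}.
        partial_hosoya (P i) (x i j) * partial_hosoya (P j) (x j i) * monom 1 (\<delta> i j))"
      \<comment> \<open>The nested sum runs over pairs with the larger index first, hence the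
        swap.\<close>
      unfolding sum.Sigma[OF finite_lessThan ballI[OF finite_lessThan]]
      by (rule sum.reindex_bij_witness[where i = prod.swap and j = prod.swap]) auto
    finally show ?thesis .
  qed
  ultimately show ?thesis by blast
qed

end
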